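(* Let $m\ge 2$, $n\ge1$, let $A\in\mathbb{R}^{n\times n}$ be diagonalizable over $\mathbb{C}$ with $r\ge1$ eigenvalues (counted with multiplicity) in the open right half plane $\mathbb{C}^+$, and let $B\in\mathbb{R}^{n\times n_B}$, $n_B<n$, be such that $(A,B)$ is stabilizable. Let $Q$ be an invertible matrix whose columns are eigenvectors of $A$, ordered so that $S:=Q^{-1}AQ=\mathrm{diag}(\lambda_A^1,\dots,\lambda_A^n)$ with $\mathrm{Re}(\lambda_A^1)\ge\cdots\ge \mathrm{Re}(\lambda_A^n)$, $\lambda_A^1,\dots,\lambda_A^r\in\mathbb{C}^+$, and $\lambda_A^{r+1},\dots,\lambda_A^n$ in the closed left half plane. Let $\Omega=\{\mathcal{L}^1,\dots,\mathcal{L}^v\}$ be a finite set of Laplacian matrices, each $\mathcal{L}^i$ being the Laplacian of an undirected, connected weighted graph $G_i$ on $\{1,\dots,m\}$, and let $$\lambda_\Omega^2:=\min\{\lambda_{\mathcal{L}^i}^2 : i=1,\dots,v\},$$ where $\lambda_{\mathcal{L}^i}^2$ is the second smallest eigenvalue of $\mathcal{L}^i$. Fix $\underline{h}>0$. Let $\Gamma=\mathrm{diag}(\gamma^1,\dots,\gamma^n)$ with real entries, $\gamma^1=\cdots=\gamma^r$ and $\gamma^{r+1}=\cdots=\gamma^n=1$. Consider the multi-agent system $$\dot{x}_i(t)=S x_i(t)+\Gamma\sum_{j=1}^m\alpha_{ij}(t)\,(x_j(t)-x_i(t)),\qquad i=1,\dots,m,$$ under arbitrary switching of the communication graph with dwell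 time $\underline{h}$, i.e. the Laplacian $\mathcal{L}(t)$ of the weights $\alpha_{ij}(t)$ satisfies $\mathcal{L}(t)=\mathcal{L}^{\sigma(t)}\in\Omega$ for all $t$, where $\sigma$ is an arbitrary admissible switching signal. Then the system reaches consensus exponentially (for every admissible switching signal) if and only if $$\mathrm{Re}(\lambda_A^1)-\gamma^1\lambda_\Omega^2<0.$$
   Context: Graphs: an undirected weighted graph on $\{1,\dots,m\}$ has weights $\alpha_{ij}=\alpha_{ji}\ge0$ ($i\ne j$), with an edge between $i$ and $j$ iff $\alpha_{ij}>0$; its Laplacian has $\mathcal{L}_{ij}=-\alpha_{ij}$ for $i\ne j$ and $\mathcal{L}_{ii}=\sum_{j\neq i}\alpha_{ij}$. Such $\mathcal{L}$ is symmetric with real eigenvalues $0=\lambda^1_{\mathcal{L}}\le\lambda^2_{\mathcal{L}}\le\cdots\le\lambda^m_{\mathcal{L}}$ (counted with multiplicity). Admissible switching signal: a function $\sigma:[0,\infty)\to\{1,\dots,v\}$ for which there are instants $0=t_0<t_1<t_2<\cdots$ with $t_{k+1}-t_k\ge\underline{h}$ for all $k$, such that $\sigma$ is constant on each $[t_k,t_{k+1})$ (consecutive values are allowed to coincide). Consensus: the states are $x_i(t)\in\mathbb{C}^n$. For a given switching signal, the system reaches consensus exponentially if there are $c,\mu>0$ such that for all initial conditions, $\|x_i(t)-x_j(t)\|\le c\,e^{-\mu t}\max_k\|x_k(0)\|$ for all $t\ge0$ and all $i,j$. Background: the system is the transformed form of agents $\dot w_i=Aw_i+Bu_i$, all of whose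 states are assumed measurable. The matrix $B$ does not appear in the system in the claim. *)

theory Defs
  imports
    "Jordan_Normal_Form.Char_Poly"
    "HOL-Analysis.L2_Norm"
begin

text \<open>
  Matrix rows and columns, vector components and agents are numbered from 0, so
  the first r indices are those below r. Modes of the switching signal are numbered from 1 to v.
\<close>

text \<open>A weighted graph on \<open>{..<m}\<close> is given by its weights; diagonal values are irrelevant.\<close>

definition weighted_graph :: "nat \<Rightarrow> (nat \<Rightarrow> nat \<Rightarrow> real) \<Rightarrow> bool" where
  "weighted_graph m \<alpha> \<longleftrightarrow>
     (\<forall>i<m. \<forall>j<m. i \<noteq> j \<longrightarrow> \<alpha> i j = \<alpha> j i \<and> 0 \<le> \<alpha> i j)"

definition graph_edges :: "nat \<Rightarrow> (nat \<Rightarrow> nat \<Rightarrow> real) \<Rightarrow> (nat \<times> nat) set" where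
  "graph_edges m \<alpha> = {(i, j). i < m \<and> j < m \<and> i \<noteq> j \<and> 0 < \<alpha> i j}"

definition connected_graph :: "nat \<Rightarrow> (nat \<Rightarrow> nat \<Rightarrow> real) \<Rightarrow> bool" where
  "connected_graph m \<alpha> \<longleftrightarrow> (\<forall>i<m. \<forall>j<m. (i, j) \<in> (graph_edges m \<alpha>)\<^sup>*)"

definition laplacian :: "nat \<Rightarrow> (nat \<Rightarrow> nat \<Rightarrow> real) \<Rightarrow> real mat" where
  "laplacian m \<alpha> =
     mat m m (\<lambda>(i, j). if i = j then (\<Sum>l\<in>{..<m} - {i}. \<alpha> i l) else - \<alpha> i j)"

text \<open>
  Real eigenvalues in increasing order, counted with multiplicity. For a symmetric
  matrix these are all of its eigenvalues.
\<close>

definition sorted_eigenvalues :: "real mat \<Rightarrow> real list" where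
  "sorted_eigenvalues M = sorted_list_of_multiset (proots (char_poly M))"

definition second_eigenvalue :: "real mat \<Rightarrow> real" where
  "second_eigenvalue M = sorted_eigenvalues M ! 1"

text \<open>Eigenvalues of a real matrix over the complex numbers, with algebraic multiplicity.\<close>

definition complex_spectrum :: "real mat \<Rightarrow> complex multiset" where
  "complex_spectrum A = proots (char_poly (map_mat complex_of_real A))"

definition diagonalizable_over_complex :: "real mat \<Rightarrow> bool" where
  "diagonalizable_over_complex A \<longleftrightarrow>
     (\<exists>D. diagonal_mat D \<and> similar_mat (map_mat complex_of_real A) D)"

definition hurwitz :: "real mat \<Rightarrow> bool" where
  "hurwitz A \<longleftrightarrow> (\<forall>z. eigenvalue (map_mat complex_of_real A) z \<longrightarrow> Re z < 0)"

definition stabilizable :: "real mat \<Rightarrow> real mat \<Rightarrow> bool" where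
  "stabilizable A B \<longleftrightarrow>
     (\<exists>K \<in> carrier_mat (dim_col B) (dim_row A). hurwitz (A + B * K))"

definition admissible_signal :: "real \<Rightarrow> nat \<Rightarrow> (real \<Rightarrow> nat) \<Rightarrow> bool" where
  "admissible_signal h v \<sigma> \<longleftrightarrow>
     (\<forall>t\<ge>0. \<sigma> t \<in> {1..v}) \<and>
     (\<exists>\<tau> :: nat \<Rightarrow> real. \<tau> 0 = 0 \<and> strict_mono \<tau> \<and>
        (\<forall>k. \<tau> (Suc k) - \<tau> k \<ge> h) \<and>
        (\<forall>k. \<forall>t\<in>{\<tau> k..<\<tau> (Suc k)}. \<sigma> t = \<sigma> (\<tau> k)))"

definition vec_norm2 :: "complex vec \<Rightarrow> real" where
  "vec_norm2 x = L2_set (\<lambda>k. cmod (x $ k)) {..<dim_vec x}"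

text \<open>
  Right-hand side of the equation of agent i, at the states \<open>x 0, \<dots>, x (m - 1)\<close>
  and the current weights \<open>\<alpha>\<close>.
\<close>

definition agent_rhs ::
  "nat \<Rightarrow> nat \<Rightarrow> complex mat \<Rightarrow> complex mat \<Rightarrow> (nat \<Rightarrow> nat \<Rightarrow> real) \<Rightarrow>
   (nat \<Rightarrow> complex vec) \<Rightarrow> nat \<Rightarrow> complex vec" where
  "agent_rhs m n S \<Gamma> \<alpha> x i =
     S *\<^sub>v x i +
     \<Gamma> *\<^sub>v vec n (\<lambda>k. \<Sum>j<m. complex_of_real (\<alpha> i j) * (x j $ k - x i $ k))"

text \<open>
  Solutions are continuous and satisfy the differential equation on every interval
  \<open>[a, b)\<close> on which the signal is constant (at the left end point the derivative is
  the right-hand one). Here \<open>x i t\<close> is the state of agent i at time t; continuity and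
  derivatives are taken componentwise.
\<close>

definition is_solution ::
  "nat \<Rightarrow> nat \<Rightarrow> complex mat \<Rightarrow> complex mat \<Rightarrow> (nat \<Rightarrow> nat \<Rightarrow> nat \<Rightarrow> real) \<Rightarrow>
   (real \<Rightarrow> nat) \<Rightarrow> (nat \<Rightarrow> real \<Rightarrow> complex vec) \<Rightarrow> bool" where
  "is_solution m n S \<Gamma> W \<sigma> x \<longleftrightarrow>
     (\<forall>i<m. \<forall>t\<ge>0. x i t \<in> carrier_vec n) \<and>
     (\<forall>i<m. \<forall>k<n. continuous_on {0..} (\<lambda>t. x i t $ k)) \<and>
     (\<forall>a b. 0 \<le> a \<longrightarrow> a < b \<longrightarrow> (\<forall>t\<in>{a..<b}. \<sigma> t = \<sigma> a) \<longrightarrow>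
        (\<forall>t\<in>{a..<b}. \<forall>i<m. \<forall>k<n.
           ((\<lambda>s. x i s $ k) has_vector_derivative
              (agent_rhs m n S \<Gamma> (W (\<sigma> t)) (\<lambda>j. x j t) i $ k)) (at t within {a..<b})))"

definition reaches_consensus_exponentially ::
  "nat \<Rightarrow> nat \<Rightarrow> complex mat \<Rightarrow> complex mat \<Rightarrow> (nat \<Rightarrow> nat \<Rightarrow> nat \<Rightarrow> real) \<Rightarrow>
   (real \<Rightarrow> nat) \<Rightarrow> bool" where
  "reaches_consensus_exponentially m n S \<Gamma> W \<sigma> \<longleftrightarrow>
     (\<exists>c>0. \<exists>\<mu>>0. \<forall>x. is_solution m n S \<Gamma> W \<sigma> x \<longrightarrow>
        (\<forall>t\<ge>0. \<forall>i<m. \<forall>j<m.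
           vec_norm2 (x i t - x j t)
             \<le> c * exp (- \<mu> * t) * Max ((\<lambda>k. vec_norm2 (x k 0)) ` {..<m})))"

end

theory Submission
  imports Defs "HOL-Analysis.Function_Topology"
begin

text \<open>
  As the system matrices are diagonal, the k-th components of all agents form a scalar network
  with rate \<open>lam k\<close> and gain \<open>\<gamma> k\<close>. The squared deviation of these components from
  their average is a common Lyapunov function of all modes: its logarithmic derivative is at most
  \<open>2 * (Re (lam k) - \<gamma> k * lam_Omega)\<close>, because the second eigenvalue minimises the
  Rayleigh quotient of the Laplacian over the vectors of sum zero. Conversely, under the constant
  signal that selects a graph attaining \<open>lam_Omega\<close>, an eigenvector \<open>w\<close> of the second
  eigenvalue gives the solution \<open>w i * exp ((lam 0 - \<gamma> 0 * lam_Omega) * t)\<close>.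
\<close>

section \<open>The graph Laplacian as an operator on functions, and its Dirichlet form\<close>

text \<open>The Laplacian acting on functions instead of vectors. The difference vanishes at
  \<open>j = i\<close>, so the sum may run over all \<open>j\<close>, whatever value
  \<open>\<alpha>\<close> has on the diagonal.\<close>

definition lap :: "nat \<Rightarrow> (nat \<Rightarrow> nat \<Rightarrow> real) \<Rightarrow> (nat \<Rightarrow> real) \<Rightarrow> nat \<Rightarrow> real" where
  "lap m \<alpha> x i = (\<Sum>j<m. \<alpha> i j * (x i - x j))"

lemma laplacian_mult_vec:
  assumes "w \<in> carrier_vec m" "i < m"
  shows "(laplacian m \<alpha> *\<^sub>v w) $ i = lap m \<alpha> (($) w) i"
proof -
  have "(laplacian m \<alpha> *\<^sub>v w) $ i
      = (\<Sum>j<m. (if i = j then (\<Sum>l\<in>{..<m} - {i}. \<alpha> i l) else - \<alpha> i j) * w $ j)"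
    using assms by (auto simp: laplacian_def scalar_prod_def lessThan_atLeast0 intro!: sum.cong)
  also have "\<dots> = (\<Sum>l\<in>{..<m} - {i}. \<alpha> i l) * w $ i + (\<Sum>j\<in>{..<m} - {i}. - \<alpha> i j * w $ j)"
    using assms(2) by (subst sum.remove[of _ i]) auto
  also have "\<dots> = (\<Sum>j\<in>{..<m} - {i}. \<alpha> i j * (w $ i - w $ j))"
    by (simp add: sum_distrib_right right_diff_distrib sum_subtractf sum_negf)
  also have "\<dots> = lap m \<alpha> (($) w) i"
    using assms(2) unfolding lap_def by (subst (2) sum.remove[of _ i]) auto
  finally show ?thesis .
qed

text \<open>Exchanging the summation indices and using the symmetry of the weights turns the factor
  \<open>y i\<close> into \<open>- y j\<close>; averaging the two forms gives the right-hand side.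
  It is symmetric in \<open>x\<close> and \<open>y\<close>, so the Laplacian is self-adjoint, and
  \<open>y = x\<close> yields the Dirichlet form.\<close>

lemma sum_mult_lap:
  assumes "weighted_graph m \<alpha>"
  shows "(\<Sum>i<m. y i * lap m \<alpha> x i) = (\<Sum>i<m. \<Sum>j<m. \<alpha> i j * ((x i - x j) * (y i - y j))) / 2"
proof -
  have sym: "\<alpha> i j = \<alpha> j i" if "i < m" "j < m" for i j
    using assms that by (cases "i = j") (auto simp: weighted_graph_def)
  have 1: "(\<Sum>i<m. y i * lap m \<alpha> x i) = (\<Sum>i<m. \<Sum>j<m. \<alpha> i j * ((x i - x j) * y i))"
    by (simp add: lap_def sum_distrib_left algebra_simps)
  also have "\<dots> = (\<Sum>i<m. \<Sum>j<m. \<alpha> j i * ((x j - x i) * y j))"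
    by (rule sum.swap)
  also have "\<dots> = (\<Sum>i<m. \<Sum>j<m. - (\<alpha> i j * ((x i - x j) * y j)))"
  proof (intro sum.cong refl)
    fix i j assume "i \<in> {..<m}" "j \<in> {..<m}"
    then have "\<alpha> j i = \<alpha> i j" using sym by simp
    then show "\<alpha> j i * ((x j - x i) * y j) = - (\<alpha> i j * ((x i - x j) * y j))"
      by (simp add: algebra_simps)
  qed
  finally have 2: "(\<Sum>i<m. y i * lap m \<alpha> x i) = (\<Sum>i<m. \<Sum>j<m. - (\<alpha> i j * ((x i - x j) * y j)))" .
  have "2 * (\<Sum>i<m. y i * lap m \<alpha> x i)
      = (\<Sum>i<m. \<Sum>j<m. \<alpha> i j * ((x i - x j) * y i)) + (\<Sum>i<m. \<Sum>j<m. - (\<alpha> i j * ((x i - x j) * y j)))"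
    using 1 2 by simp
  also have "\<dots> = (\<Sum>i<m. \<Sum>j<m. \<alpha> i j * ((x i - x j) * (y i - y j)))"
    by (simp add: sum.distrib[symmetric] right_diff_distrib)
  finally show ?thesis by simp
qed

lemma sum_mult_lap_commute:
  assumes "weighted_graph m \<alpha>"
  shows "(\<Sum>i<m. y i * lap m \<alpha> x i) = (\<Sum>i<m. x i * lap m \<alpha> y i)"
  by (simp add: sum_mult_lap[OF assms] mult.commute)

lemma sum_lap:
  assumes "weighted_graph m \<alpha>"
  shows "(\<Sum>i<m. lap m \<alpha> x i) = 0"
  using sum_mult_lap[OF assms, of "\<lambda>_. 1" x] by simp

lemma dirichlet_term_nonneg:
  assumes "weighted_graph m \<alpha>" "i < m" "j < m"
  shows "0 \<le> \<alpha> i j * ((x i - x j) * (x i - x j))"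
  using assms by (cases "i = j") (auto simp: weighted_graph_def)

lemma dirichlet_nonneg:
  assumes "weighted_graph m \<alpha>"
  shows "0 \<le> (\<Sum>i<m. x i * lap m \<alpha> x i)"
  unfolding sum_mult_lap[OF assms]
  using dirichlet_term_nonneg[OF assms] by (auto intro!: sum_nonneg)

text \<open>All summands of the Dirichlet form are nonnegative, so each is 0 and \<open>x\<close>
  agrees at both ends of every edge; connectedness carries this along a path from \<open>i\<close>
  to \<open>j\<close>.\<close>

lemma dirichlet_eq_0_imp_constant:
  assumes "weighted_graph m \<alpha>" "connected_graph m \<alpha>"
    and "(\<Sum>i<m. x i * lap m \<alpha> x i) = 0" "i < m" "j < m"
  shows "x i = x j"
proof -
  have 0: "(\<Sum>i<m. \<Sum>j<m. \<alpha> i j * ((x i - x j) * (x i - x j))) = 0"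
    using assms(3) by (simp add: sum_mult_lap[OF assms(1)])
  have z: "\<alpha> i j * ((x i - x j) * (x i - x j)) = 0" if "i < m" "j < m" for i j
  proof -
    have nonneg: "0 \<le> \<alpha> k l * ((x k - x l) * (x k - x l))" if "k < m" "l < m" for k l
      using dirichlet_term_nonneg[OF assms(1) that] .
    have "(\<Sum>l<m. \<alpha> i l * ((x i - x l) * (x i - x l))) = 0"
      using 0 that(1) sum_nonneg_0[OF _ _ 0, of i] nonneg by (auto intro!: sum_nonneg)
    from sum_nonneg_0[OF _ _ this, of j] that nonneg show ?thesis by auto
  qed
  have "(i, j) \<in> (graph_edges m \<alpha>)\<^sup>*" using assms by (auto simp: connected_graph_def)
  then show ?thesis
  proof (induction rule: rtrancl_induct)
    case (step k l)
    then show ?case using z[of k l] by (auto simp: graph_edges_def)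
  qed simp
qed

section \<open>Variational construction of the algebraic connectivity\<close>

text \<open>Tychonoff's theorem: pinning the coordinates from \<open>m\<close> on to 0 makes the set
  a product of compact sets, so functions can stand in for vectors of length
  \<open>m\<close>.\<close>

lemma compact_support_cube: "compact {x :: nat \<Rightarrow> real. (\<forall>i<m. \<bar>x i\<bar> \<le> 1) \<and> (\<forall>i\<ge>m. x i = 0)}"
proof -
  let ?S = "\<lambda>i. if i < m then {-1..1::real} else {0}"
  have "compactin (product_topology (\<lambda>_. euclidean) UNIV) (PiE UNIV ?S)"
    by (subst compactin_PiE) auto
  moreover have "PiE UNIV ?S = {x. (\<forall>i<m. \<bar>x i\<bar> \<le> 1) \<and> (\<forall>i\<ge>m. x i = 0)}"
    by (auto simp: PiE_iff abs_le_iff split: if_splits)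
  ultimately show ?thesis
    by (simp add: euclidean_product_topology)
qed

text \<open>Minimising the Rayleigh quotient over the unit sphere of the complement of the constants.\<close>

lemma algebraic_connectivity_exists:
  assumes "weighted_graph m \<alpha>" "connected_graph m \<alpha>" "m \<ge> 2"
  obtains \<rho> w where "\<rho> > 0" "(\<Sum>i<m. w i) = 0" "(\<Sum>i<m. (w i)\<^sup>2) = 1"
    "\<And>i. i < m \<Longrightarrow> lap m \<alpha> w i = \<rho> * w i"
    "\<And>x. (\<Sum>i<m. x i) = 0 \<Longrightarrow> \<rho> * (\<Sum>i<m. (x i)\<^sup>2) \<le> (\<Sum>i<m. x i * lap m \<alpha> x i)"
proof -
  define q where "q x = (\<Sum>i<m. x i * lap m \<alpha> x i)" for x
  \<comment> \<open>The last two sets are closed and cut out the unit sphere of the sum-zero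
    subspace; the cube supplies compactness.\<close>
  define K where "K = {x. (\<forall>i<m. \<bar>x i\<bar> \<le> 1) \<and> (\<forall>i\<ge>m. x i = 0)}
      \<inter> {x. (\<Sum>i<m. x i) = 0} \<inter> {x :: nat \<Rightarrow> real. (\<Sum>i<m. (x i)\<^sup>2) = 1}"
  have c: "continuous_on A (\<lambda>x :: nat \<Rightarrow> real. x i)" for i A
    by (rule continuous_on_subset[OF continuous_on_product_coordinates]) simp
  have "compact K" unfolding K_def
    by (intro compact_Int_closed compact_support_cube closed_Collect_eq continuous_intros c)
  moreover have "continuous_on K q"
    unfolding q_def lap_def by (intro continuous_intros c)
  \<comment> \<open>The normalised difference of the first two unit vectors shows that
    \<open>K\<close> is nonempty; here \<open>m \<ge> 2\<close> enters.\<close>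
  moreover have "(\<lambda>i. if i = 0 then 1 / sqrt 2 else if i = 1 then - 1 / sqrt 2 else 0) \<in> K"
  proof -
    have e: "(\<Sum>i<m. f i) = f 0 + f 1" if "\<And>i. i \<ge> 2 \<Longrightarrow> f i = 0" for f :: "nat \<Rightarrow> real"
    proof -
      have "(\<Sum>i<m. f i) = (\<Sum>i<2. f i)"
        using assms(3) that by (intro sum.mono_neutral_right) auto
      then show ?thesis by (simp add: numeral_2_eq_2)
    qed
    show ?thesis using assms(3)
      by (auto simp: K_def e power_divide)
  qed
  ultimately obtain w where w: "w \<in> K" "\<And>x. x \<in> K \<Longrightarrow> q w \<le> q x"
    using continuous_attains_inf[of K q] by blast
  define \<rho> where "\<rho> = q w"
  have w0: "(\<Sum>i<m. w i) = 0" and w1: "(\<Sum>i<m. (w i)\<^sup>2) = 1" using w(1) by (auto simp: K_def)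
  \<comment> \<open>Membership in \<open>K\<close> forces truncation to 0 from \<open>m\<close> on;
    \<open>q\<close> does not see this change.\<close>
  have q_cong: "q x = q y" if "\<And>i. i < m \<Longrightarrow> x i = y i" for x y
    using that by (auto simp: q_def lap_def)
  have q_scale: "q (\<lambda>i. c * x i) = c\<^sup>2 * q x" for c x
    by (simp add: q_def lap_def sum_distrib_left power2_eq_square algebra_simps)
  have min: "\<rho> * (\<Sum>i<m. (x i)\<^sup>2) \<le> q x" if x: "(\<Sum>i<m. x i) = 0" for x
  proof (cases "(\<Sum>i<m. (x i)\<^sup>2) = 0")
    case True
    then show ?thesis using dirichlet_nonneg[OF assms(1)] by (simp add: q_def)
  next
    case False
    define N where "N = (\<Sum>i<m. (x i)\<^sup>2)"
    have N: "N > 0" using False by (simp add: N_def sum_nonneg less_le)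
    define y where "y i = (if i < m then (1 / sqrt N) * x i else 0)" for i
    have le: "(x i)\<^sup>2 \<le> N" if "i < m" for i
      unfolding N_def using that by (intro member_le_sum) auto
    have "\<bar>y i\<bar> \<le> 1" if "i < m" for i
      using real_le_rsqrt[of "\<bar>x i\<bar>" N] le[OF that] that N by (simp add: y_def)
    moreover have "(\<Sum>i<m. y i) = 0" "(\<Sum>i<m. (y i)\<^sup>2) = 1"
      using x N by (simp_all add: y_def power_divide sum_divide_distrib[symmetric] flip: N_def)
    ultimately have "y \<in> K" by (auto simp: K_def y_def)
    then have "\<rho> \<le> q y" using w(2) by (simp add: \<rho>_def)
    also have "q y = (1 / sqrt N)\<^sup>2 * q x"
      unfolding q_scale[symmetric] by (rule q_cong) (simp add: y_def)
    finally show ?thesis using N by (simp add: power_divide field_simps flip: N_def)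
  qed
  \<comment> \<open>The residual of the eigenvalue equation. Its sum is 0, so
    \<open>w + t * g\<close> stays in the subspace on which \<open>min\<close> applies.\<close>
  define g where "g i = lap m \<alpha> w i - \<rho> * w i" for i
  have g0: "(\<Sum>i<m. g i) = 0"
    by (simp add: g_def sum_subtractf sum_lap[OF assms(1)] sum_distrib_left[symmetric] w0)
  \<comment> \<open>Were the minimum 0, connectedness would make \<open>w\<close> constant, and a
    constant of sum 0 contradicts norm 1.\<close>
  have "\<rho> > 0"
  proof (rule ccontr)
    assume "\<not> \<rho> > 0"
    then have "q w = 0" using dirichlet_nonneg[OF assms(1), of w] by (simp add: \<rho>_def q_def)
    then have const: "w i = w 0" if "i < m" for i
      using dirichlet_eq_0_imp_constant[OF assms(1,2), of w i 0] assms(3) that by (simp add: q_def)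
    have "(\<Sum>i<m. w i) = (\<Sum>i<m. w 0)" "(\<Sum>i<m. (w i)\<^sup>2) = (\<Sum>i<m. (w 0)\<^sup>2)"
      by (intro sum.cong refl; metis const lessThan_iff)+
    then show False using w0 w1 by auto
  qed
  \<comment> \<open>Perturbing \<open>w\<close> in the direction of the residual \<open>g\<close> forces \<open>g = 0\<close>.\<close>
  define G where "G = (\<Sum>i<m. (g i)\<^sup>2)"
  define C where "C = q g - \<rho> * G"
  have pert: "0 \<le> 2 * t * G + t\<^sup>2 * C" for t
  proof -
    have cross: "(\<Sum>i<m. w i * lap m \<alpha> g i) = (\<Sum>i<m. g i * lap m \<alpha> w i)"
      by (rule sum_mult_lap_commute[OF assms(1)])
    have "lap m \<alpha> (\<lambda>i. w i + t * g i) i = lap m \<alpha> w i + t * lap m \<alpha> g i" for i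
      by (simp add: lap_def sum_distrib_left sum.distrib[symmetric] algebra_simps)
    then have "q (\<lambda>i. w i + t * g i)
        = (\<Sum>i<m. w i * lap m \<alpha> w i + t * (w i * lap m \<alpha> g i) + t * (g i * lap m \<alpha> w i)
            + t\<^sup>2 * (g i * lap m \<alpha> g i))"
      by (simp add: q_def power2_eq_square algebra_simps)
    also have "\<dots> = \<rho> + 2 * t * (\<Sum>i<m. g i * lap m \<alpha> w i) + t\<^sup>2 * q g"
      by (simp add: sum.distrib sum_distrib_left[symmetric] cross \<rho>_def q_def)
    finally have 1: "q (\<lambda>i. w i + t * g i) = \<rho> + 2 * t * (\<Sum>i<m. g i * lap m \<alpha> w i) + t\<^sup>2 * q g" .
    have "(\<Sum>i<m. (w i + t * g i)\<^sup>2) = (\<Sum>i<m. (w i)\<^sup>2 + 2 * t * (g i * w i) + t\<^sup>2 * (g i)\<^sup>2)"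
      by (simp add: power2_eq_square algebra_simps)
    also have "\<dots> = 1 + 2 * t * (\<Sum>i<m. g i * w i) + t\<^sup>2 * G"
      by (simp add: sum.distrib sum_distrib_left[symmetric] w1 G_def)
    finally have 2: "(\<Sum>i<m. (w i + t * g i)\<^sup>2) = 1 + 2 * t * (\<Sum>i<m. g i * w i) + t\<^sup>2 * G" .
    \<comment> \<open>This identifies the first-order coefficient of the expansion with
      \<open>G\<close>, the pairing of \<open>g\<close> with itself.\<close>
    have 3: "G = (\<Sum>i<m. g i * lap m \<alpha> w i) - \<rho> * (\<Sum>i<m. g i * w i)"
      by (simp add: G_def g_def power2_eq_square sum_distrib_left sum_subtractf[symmetric] algebra_simps)
    have "(\<Sum>i<m. w i + t * g i) = 0"
      by (simp add: sum.distrib w0 g0 sum_distrib_left[symmetric])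
    from min[OF this] show ?thesis
      unfolding 1 2 C_def by (simp add: 3 algebra_simps)
  qed
  have "G = 0"
  proof (rule ccontr)
    assume "G \<noteq> 0"
    then have G: "G > 0" by (simp add: G_def sum_nonneg less_le)
    \<comment> \<open>A negative step so short that the first-order term dominates the second-order
      one; adding 1 keeps the denominator positive when \<open>C = 0\<close>.\<close>
    define t where "t = - G / (\<bar>C\<bar> + 1)"
    have "t < 0" using G by (simp add: t_def divide_neg_pos)
    have "- t * \<bar>C\<bar> \<le> G" using G by (simp add: t_def field_simps)
    then have "- t * C \<le> G" using \<open>t < 0\<close> abs_ge_self[of C] mult_left_mono[of C "\<bar>C\<bar>" "- t"] by linarith
    then have "2 * G + t * C > 0" using G by linarith
    then have "t * (2 * G + t * C) < 0" using \<open>t < 0\<close> by (simp add: mult_neg_pos)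
    then show False using pert[of t] by (simp add: power2_eq_square algebra_simps)
  qed
  then have "lap m \<alpha> w i = \<rho> * w i" if "i < m" for i
    using that by (simp add: G_def sum_nonneg_eq_0_iff g_def)
  then show ?thesis
    using that[of \<rho> w] \<open>\<rho> > 0\<close> w0 w1 min by (simp add: q_def)
qed

section \<open>The spectrum of the Laplacian matrix\<close>

lemma laplacian_carrier: "laplacian m \<alpha> \<in> carrier_mat m m"
  by (simp add: laplacian_def)

lemma laplacian_row_sum:
  assumes "i < m"
  shows "(\<Sum>j<m. laplacian m \<alpha> $$ (i, j)) = 0"
proof -
  have "(\<Sum>j<m. laplacian m \<alpha> $$ (i, j))
      = (\<Sum>l\<in>{..<m} - {i}. \<alpha> i l) + (\<Sum>j\<in>{..<m} - {i}. - \<alpha> i j)"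
    using assms by (subst sum.remove[of _ i]) (auto simp: laplacian_def)
  then show ?thesis by (simp add: sum_negf)
qed

lemma laplacian_eigenvalue_iff:
  "eigenvalue (laplacian m \<alpha>) k \<longleftrightarrow> (\<exists>x. (\<exists>i<m. x i \<noteq> 0) \<and> (\<forall>i<m. lap m \<alpha> x i = k * x i))"
proof
  assume "eigenvalue (laplacian m \<alpha>) k"
  then obtain w where w: "w \<in> carrier_vec m" "w \<noteq> 0\<^sub>v m" "laplacian m \<alpha> *\<^sub>v w = k \<cdot>\<^sub>v w"
    by (auto simp: eigenvalue_def eigenvector_def laplacian_def)
  have "\<exists>i<m. w $ i \<noteq> 0" using w(1,2) by (auto intro: eq_vecI)
  moreover have "lap m \<alpha> (($) w) i = k * w $ i" if "i < m" for i
    using laplacian_mult_vec[OF w(1) that, of \<alpha>] w that by simp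
  ultimately show "\<exists>x. (\<exists>i<m. x i \<noteq> 0) \<and> (\<forall>i<m. lap m \<alpha> x i = k * x i)" by blast
next
  assume "\<exists>x. (\<exists>i<m. x i \<noteq> 0) \<and> (\<forall>i<m. lap m \<alpha> x i = k * x i)"
  then obtain x where x: "\<exists>i<m. x i \<noteq> 0" "\<And>i. i < m \<Longrightarrow> lap m \<alpha> x i = k * x i" by blast
  have "lap m \<alpha> (($) (vec m x)) i = lap m \<alpha> x i" if "i < m" for i
    using that by (simp add: lap_def)
  then have "laplacian m \<alpha> *\<^sub>v vec m x = k \<cdot>\<^sub>v vec m x"
    using laplacian_mult_vec[of "vec m x" m _ \<alpha>] x(2)
    by (intro eq_vecI) (auto simp: laplacian_def)
  moreover have "vec m x \<noteq> 0\<^sub>v m" using x(1) by (metis index_vec index_zero_vec(1))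
  ultimately show "eigenvalue (laplacian m \<alpha>) k"
    unfolding eigenvalue_def eigenvector_def by (intro exI[of _ "vec m x"]) (simp add: laplacian_def)
qed

text \<open>
  Conjugation by the matrix that replaces the first unit vector by the all-ones vector
  splits off the eigenvalue 0.
\<close>

lemma char_poly_laplacian_reduce:
  assumes "m = Suc k"
  shows "char_poly (laplacian m \<alpha>) = [:0, 1:] *
    char_poly (mat k k (\<lambda>(i, j). laplacian m \<alpha> $$ (Suc i, Suc j) - laplacian m \<alpha> $$ (0, Suc j)))"
proof -
  let ?L = "laplacian m \<alpha>"
  define P :: "real mat" where "P = mat m m (\<lambda>(i, j). if i = j \<or> j = 0 then 1 else 0)"
  define P' :: "real mat" where "P' = mat m m (\<lambda>(i, j). if i = j then 1 else if j = 0 then - 1 else 0)"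
  \<comment> \<open>\<open>C\<close> is \<open>P' * ?L * P\<close>: column 0 vanishes because the
    rows of the Laplacian sum to 0, and multiplying by \<open>P'\<close> from the left subtracts row
    0 from the other rows.\<close>
  define C :: "real mat" where
    "C = mat m m (\<lambda>(i, j). if j = 0 then 0 else if i = 0 then ?L $$ (0, j) else ?L $$ (i, j) - ?L $$ (0, j))"
  have m: "0 < m" using assms by simp
  have carr: "?L \<in> carrier_mat m m" "P \<in> carrier_mat m m" "P' \<in> carrier_mat m m" "C \<in> carrier_mat m m"
    by (simp_all add: laplacian_carrier P_def P'_def C_def)
  have prod: "(X * Y) $$ (i, j) = (\<Sum>l<m. X $$ (i, l) * Y $$ (l, j))"
    if "X \<in> carrier_mat m m" "Y \<in> carrier_mat m m" "i < m" "j < m" for X Y :: "real mat" and i j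
    using that by (auto simp: scalar_prod_def lessThan_atLeast0 intro!: sum.cong)
  have first: "(\<Sum>l<m. f l) = f 0 + (\<Sum>l\<in>{..<m} - {0}. f l)" for f :: "nat \<Rightarrow> real"
    using m by (subst sum.remove[of _ 0]) auto
  have row: "(\<Sum>l<m. P $$ (i, l) * f l) = (if i = 0 then f 0 else f 0 + f i)" if "i < m" for i f
  proof -
    have "(\<Sum>l\<in>{..<m} - {0}. P $$ (i, l) * f l) = (\<Sum>l\<in>{..<m} - {0}. if i = l then f l else 0)"
      using that by (intro sum.cong) (auto simp: P_def)
    then show ?thesis using that m by (subst first) (auto simp: P_def)
  qed
  have row': "(\<Sum>l<m. P' $$ (i, l) * f l) = (if i = 0 then f 0 else f i - f 0)" if "i < m" for i f
  proof -
    have "(\<Sum>l\<in>{..<m} - {0}. P' $$ (i, l) * f l) = (\<Sum>l\<in>{..<m} - {0}. if i = l then f l else 0)"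
      using that by (intro sum.cong) (auto simp: P'_def)
    then show ?thesis using that m by (subst first) (auto simp: P'_def)
  qed
  have PP': "P * P' = 1\<^sub>m m"
  proof (rule eq_matI)
    fix i j assume "i < dim_row (1\<^sub>m m :: real mat)" "j < dim_col (1\<^sub>m m :: real mat)"
    then have ij: "i < m" "j < m" by auto
    show "(P * P') $$ (i, j) = 1\<^sub>m m $$ (i, j)"
      unfolding prod[OF carr(2,3) ij] row[OF ij(1)] using ij m by (auto simp: P'_def)
  qed (use carr in auto)
  have P'P: "P' * P = 1\<^sub>m m"
  proof (rule eq_matI)
    fix i j assume "i < dim_row (1\<^sub>m m :: real mat)" "j < dim_col (1\<^sub>m m :: real mat)"
    then have ij: "i < m" "j < m" by auto
    show "(P' * P) $$ (i, j) = 1\<^sub>m m $$ (i, j)"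
      unfolding prod[OF carr(3,2) ij] row'[OF ij(1)] using ij m by (auto simp: P_def)
  qed (use carr in auto)
  have "?L * P = P * C"
  proof (rule eq_matI)
    fix i j assume "i < dim_row (P * C)" "j < dim_col (P * C)"
    then have ij: "i < m" "j < m" using carr by auto
    have l: "(?L * P) $$ (i, j) = ?L $$ (i, j)" if "j \<noteq> 0"
    proof -
      have "(?L * P) $$ (i, j) = (\<Sum>l<m. if l = j then ?L $$ (i, l) else 0)"
        unfolding prod[OF carr(1,2) ij] using ij that by (intro sum.cong) (auto simp: P_def)
      then show ?thesis using ij by simp
    qed
    have l0: "(?L * P) $$ (i, 0) = 0"
    proof -
      have "(?L * P) $$ (i, 0) = (\<Sum>l<m. ?L $$ (i, l))"
        unfolding prod[OF carr(1,2) ij(1) m] by (intro sum.cong) (auto simp: P_def)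
      then show ?thesis using laplacian_row_sum[OF ij(1)] by simp
    qed
    show "(?L * P) $$ (i, j) = (P * C) $$ (i, j)"
      unfolding prod[OF carr(2,4) ij] row[OF ij(1)] using ij m l l0
      by (cases "j = 0") (auto simp: C_def)
  qed (use carr in auto)
  moreover have "?L = ?L * P * P'"
    using carr PP' by (simp add: assoc_mult_mat[of _ m m _ m _ m])
  ultimately have "similar_mat_wit ?L C P P'"
    using carr PP' P'P by (intro similar_mat_witI[of _ _ m]) auto
  then have "char_poly ?L = char_poly C"
    by (intro char_poly_similar) (auto simp: similar_mat_def)
  also have "C = four_block_mat (0\<^sub>m 1 1) (mat 1 k (\<lambda>(i, j). ?L $$ (0, Suc j))) (0\<^sub>m k 1)
      (mat k k (\<lambda>(i, j). ?L $$ (Suc i, Suc j) - ?L $$ (0, Suc j)))" (is "_ = ?F")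
    by (rule eq_matI) (auto simp: C_def assms)
  also have "char_poly ?F = char_poly (0\<^sub>m 1 1) *
      char_poly (mat k k (\<lambda>(i, j). ?L $$ (Suc i, Suc j) - ?L $$ (0, Suc j)))"
    by (rule char_poly_four_block_zeros_col) auto
  also have "char_poly (0\<^sub>m 1 1 :: real mat) = [:0, 1:]"
    by (subst char_poly_upper_triangular[of _ 1]) (auto simp: diag_mat_def)
  finally show ?thesis .
qed

text \<open>A kernel vector, extended by a leading 0, is mapped by the Laplacian to a constant
  vector. That image has sum 0, so it is 0, the Dirichlet form vanishes, and the extended vector is
  constant, hence equal to its leading 0. With the factorisation above, 0 is a simple root of the
  characteristic polynomial.\<close>

lemma laplacian_reduced_regular:
  assumes "weighted_graph m \<alpha>" "connected_graph m \<alpha>" "m = Suc k"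
  shows "\<not> eigenvalue (mat k k (\<lambda>(i, j). laplacian m \<alpha> $$ (Suc i, Suc j) - laplacian m \<alpha> $$ (0, Suc j))) 0"
    (is "\<not> eigenvalue ?M 0")
proof
  assume "eigenvalue ?M 0"
  then obtain y where y: "y \<in> carrier_vec k" "y \<noteq> 0\<^sub>v k" "?M *\<^sub>v y = 0 \<cdot>\<^sub>v y"
    by (auto simp: eigenvalue_def eigenvector_def)
  define w where "w = vec m (\<lambda>i. if i = 0 then 0 else y $ (i - 1))"
  have wc: "w \<in> carrier_vec m" by (simp add: w_def)
  have L: "lap m \<alpha> (($) w) i = (\<Sum>j<k. laplacian m \<alpha> $$ (i, Suc j) * y $ j)" if "i < m" for i
  proof -
    have "lap m \<alpha> (($) w) i = (\<Sum>j<m. laplacian m \<alpha> $$ (i, j) * w $ j)"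
      using that wc laplacian_carrier[of m \<alpha>]
      by (subst laplacian_mult_vec[symmetric])
         (auto simp: scalar_prod_def lessThan_atLeast0 intro!: sum.cong)
    also have "\<dots> = (\<Sum>j<k. laplacian m \<alpha> $$ (i, Suc j) * y $ j)"
      unfolding assms(3) sum.lessThan_Suc_shift by (simp add: w_def assms(3))
    finally show ?thesis .
  qed
  \<comment> \<open>The rows of \<open>?M\<close> are Laplacian rows minus row 0, so the kernel
    equation says that every entry of the image equals entry 0.\<close>
  have const: "lap m \<alpha> (($) w) i = lap m \<alpha> (($) w) 0" if "i < m" for i
  proof (cases i)
    case (Suc i')
    then have "(?M *\<^sub>v y) $ i' = 0" using that y assms(3) by simp
    then have "(\<Sum>j<k. (laplacian m \<alpha> $$ (i, Suc j) - laplacian m \<alpha> $$ (0, Suc j)) * y $ j) = 0"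
      using that y(1) Suc assms(3) by (auto simp: scalar_prod_def lessThan_atLeast0)
    then show ?thesis using L[OF that] L[of 0] assms(3)
      by (simp add: left_diff_distrib sum_subtractf)
  qed simp
  have "(\<Sum>i<m. lap m \<alpha> (($) w) i) = (\<Sum>i<m. lap m \<alpha> (($) w) 0)"
    by (intro sum.cong refl) (metis const lessThan_iff)
  then have "lap m \<alpha> (($) w) 0 = 0" using sum_lap[OF assms(1)] assms(3) by simp
  then have "(\<Sum>i<m. w $ i * lap m \<alpha> (($) w) i) = 0"
    by (intro sum.neutral) (metis const lessThan_iff mult_zero_right)
  then have "w $ i = w $ 0" if "i < m" for i
    using dirichlet_eq_0_imp_constant[OF assms(1,2), of "($) w" i 0] that assms(3) by simp
  from this[of "Suc _"] have "y $ i = 0" if "i < k" for i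
    using that assms(3) by (simp add: w_def)
  then show False using y(1,2) by (auto intro: eq_vecI)
qed

text \<open>Identifies the list entry defining the second eigenvalue with the minimum of the
  Rayleigh quotient: 0 is a simple root, every other root is at least this minimum, and the minimum
  is itself a root.\<close>

lemma second_eigenvalue_spec:
  assumes "weighted_graph m \<alpha>" "connected_graph m \<alpha>" "m \<ge> 2"
  defines "\<rho> \<equiv> second_eigenvalue (laplacian m \<alpha>)"
  shows "\<rho> > 0"
    and "\<exists>w. (\<Sum>i<m. w i) = 0 \<and> (\<exists>i<m. w i \<noteq> 0) \<and> (\<forall>i<m. lap m \<alpha> w i = \<rho> * w i)"
    and "(\<Sum>i<m. x i) = 0 \<Longrightarrow> \<rho> * (\<Sum>i<m. (x i)\<^sup>2) \<le> (\<Sum>i<m. x i * lap m \<alpha> x i)"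
proof -
  obtain r w where r: "r > 0" "(\<Sum>i<m. w i) = 0" "(\<Sum>i<m. (w i)\<^sup>2) = 1"
    "\<And>i. i < m \<Longrightarrow> lap m \<alpha> w i = r * w i"
    "\<And>x. (\<Sum>i<m. x i) = 0 \<Longrightarrow> r * (\<Sum>i<m. (x i)\<^sup>2) \<le> (\<Sum>i<m. x i * lap m \<alpha> x i)"
    by (rule algebraic_connectivity_exists[OF assms(1-3)]) blast
  have w_ne: "\<exists>i<m. w i \<noteq> 0"
  proof (rule ccontr)
    assume "\<not> ?thesis"
    then have "(\<Sum>i<m. (w i)\<^sup>2) = 0" by (intro sum.neutral) auto
    then show False using r(3) by simp
  qed
  obtain k where k: "m = Suc k" using assms(3) by (cases m) auto
  define M where "M = mat k k (\<lambda>(i, j). laplacian m \<alpha> $$ (Suc i, Suc j) - laplacian m \<alpha> $$ (0, Suc j))"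
  have Mc: "M \<in> carrier_mat k k" by (simp add: M_def)
  have cp: "char_poly (laplacian m \<alpha>) = [:0, 1:] * char_poly M"
    unfolding M_def by (rule char_poly_laplacian_reduce[OF k])
  have M0: "char_poly M \<noteq> 0" using degree_monic_char_poly[OF Mc] by auto
  have root_iff: "eigenvalue (laplacian m \<alpha>) z \<longleftrightarrow> z = 0 \<or> poly (char_poly M) z = 0" for z
    unfolding eigenvalue_root_char_poly[OF laplacian_carrier] cp by simp
  have Mnz: "poly (char_poly M) 0 \<noteq> 0"
    using laplacian_reduced_regular[OF assms(1,2) k] eigenvalue_root_char_poly[OF Mc, of 0]
    by (simp add: M_def)
  have ge: "z \<ge> r" if z: "z \<in># proots (char_poly M)" for z
  proof -
    have "poly (char_poly M) z = 0" using z M0 by simp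
    then have "z \<noteq> 0" "eigenvalue (laplacian m \<alpha>) z" using Mnz root_iff by auto
    then obtain x where x: "\<exists>i<m. x i \<noteq> 0" "\<And>i. i < m \<Longrightarrow> lap m \<alpha> x i = z * x i"
      unfolding laplacian_eigenvalue_iff by blast
    \<comment> \<open>Images of the Laplacian have sum 0, so an eigenvector for
      \<open>z \<noteq> 0\<close> has sum 0 and the Rayleigh bound applies to it.\<close>
    have "z * (\<Sum>i<m. x i) = (\<Sum>i<m. lap m \<alpha> x i)"
      by (simp add: x(2) sum_distrib_left)
    then have "(\<Sum>i<m. x i) = 0" using sum_lap[OF assms(1)] \<open>z \<noteq> 0\<close> by simp
    from r(5)[OF this] have "r * (\<Sum>i<m. (x i)\<^sup>2) \<le> z * (\<Sum>i<m. (x i)\<^sup>2)"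
      by (simp add: x(2) sum_distrib_left power2_eq_square algebra_simps)
    moreover have "(\<Sum>i<m. (x i)\<^sup>2) > 0" using x(1) by (auto intro!: sum_pos2)
    ultimately show ?thesis by simp
  qed
  have "eigenvalue (laplacian m \<alpha>) r"
    unfolding laplacian_eigenvalue_iff using w_ne r(4) by blast
  then have rin: "r \<in># proots (char_poly M)" using root_iff r(1) M0 by simp
  define xs where "xs = sorted_list_of_multiset (proots (char_poly M))"
  have xs: "sorted xs" "set xs = set_mset (proots (char_poly M))"
    by (simp_all add: xs_def sorted_sorted_list_of_multiset)
  have "proots (char_poly (laplacian m \<alpha>)) = add_mset 0 (proots (char_poly M))"
    unfolding cp using M0 by (subst proots_mult) auto
  then have "sorted_eigenvalues (laplacian m \<alpha>) = insort 0 xs"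
    by (simp add: sorted_eigenvalues_def xs_def)
  also have "\<dots> = 0 # xs"
    using ge r(1) xs(2) by (intro insort_is_Cons) force
  \<comment> \<open>Exactly one 0 precedes \<open>xs\<close>, so index 1 of the full list is index 0
    of \<open>xs\<close>.\<close>
  finally have "\<rho> = xs ! 0" by (simp add: \<rho>_def second_eigenvalue_def)
  moreover obtain a ys where ays: "xs = a # ys" using rin xs(2) by (cases xs) auto
  ultimately have "\<rho> = a" by simp
  moreover have "a \<ge> r" using ge xs(2) ays by auto
  moreover have "a \<le> r" using xs rin ays by auto
  ultimately have "\<rho> = r" by simp
  then show "\<rho> > 0"
    and "\<exists>w. (\<Sum>i<m. w i) = 0 \<and> (\<exists>i<m. w i \<noteq> 0) \<and> (\<forall>i<m. lap m \<alpha> w i = \<rho> * w i)"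
    and "(\<Sum>i<m. x i) = 0 \<Longrightarrow> \<rho> * (\<Sum>i<m. (x i)\<^sup>2) \<le> (\<Sum>i<m. x i * lap m \<alpha> x i)"
    using r w_ne by auto
qed

section \<open>The deviation from the average as a Lyapunov function\<close>

lemma lap_diff_const: "lap m \<alpha> (\<lambda>i. x i - c) = lap m \<alpha> x"
  by (simp add: lap_def fun_eq_iff)

text \<open>The squared Euclidean distance of \<open>u\<close> from the constant vectors, that is,
  \<open>m\<close> times its variance.\<close>

definition variance_sum :: "nat \<Rightarrow> (nat \<Rightarrow> real) \<Rightarrow> real" where
  "variance_sum m u = (\<Sum>i<m. (u i - (\<Sum>j<m. u j) / m)\<^sup>2)"

lemma variance_sum_nonneg: "0 \<le> variance_sum m u"
  by (simp add: variance_sum_def sum_nonneg)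

lemma sum_deviation:
  assumes "m > 0"
  shows "(\<Sum>i<m. u i - (\<Sum>j<m. u j) / real m) = 0"
  using assms by (simp add: sum_subtractf)

text \<open>Centring removes \<open>m\<close> times the squared mean. This later bounds the Lyapunov
  function at time 0 by the initial states.\<close>

lemma variance_sum_le: "variance_sum m u \<le> (\<Sum>i<m. (u i)\<^sup>2)"
proof (cases "m = 0")
  case False
  define M where "M = (\<Sum>j<m. u j) / m"
  have M: "(\<Sum>j<m. u j) = m * M" using False by (simp add: M_def)
  have "variance_sum m u = (\<Sum>i<m. (u i)\<^sup>2 - 2 * M * u i + M\<^sup>2)"
    by (simp add: variance_sum_def power2_diff algebra_simps flip: M_def)
  also have "\<dots> = (\<Sum>i<m. (u i)\<^sup>2) - m * M\<^sup>2"
    by (simp add: sum.distrib sum_subtractf sum_distrib_left[symmetric] M power2_eq_square)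
  finally show ?thesis by simp
qed (simp add: variance_sum_def)

text \<open>An instance of \<open>(a - b)^2 \<le> 2 * (a^2 + b^2)\<close> for two deviations. It
  converts decay of the Lyapunov function into decay of pairwise differences.\<close>

lemma diff_squared_le_variance_sum:
  assumes "i < m" "j < m"
  shows "(u i - u j)\<^sup>2 \<le> 2 * variance_sum m u"
proof (cases "i = j")
  case True
  then show ?thesis by (simp add: variance_sum_nonneg)
next
  case False
  define M where "M = (\<Sum>j<m. u j) / m"
  have "(u i - u j)\<^sup>2 \<le> 2 * ((u i - M)\<^sup>2 + (u j - M)\<^sup>2)"
    using zero_le_power2[of "u i - M + (u j - M)"] by (simp add: power2_eq_square algebra_simps)
  also have "(u i - M)\<^sup>2 + (u j - M)\<^sup>2 = (\<Sum>l\<in>{i, j}. (u l - M)\<^sup>2)"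
    using False by simp
  also have "\<dots> \<le> variance_sum m u"
    unfolding variance_sum_def M_def[symmetric] using assms by (intro sum_mono2) auto
  finally show ?thesis by simp
qed

text \<open>The derivative of the mean drops out, because it is common to all \<open>i\<close> and
  the deviations sum to 0.\<close>

lemma has_real_derivative_variance_sum:
  assumes "m > 0" "\<And>i. i < m \<Longrightarrow> ((\<lambda>t. u i t) has_real_derivative D i) (at t)"
  shows "((\<lambda>t. variance_sum m (\<lambda>i. u i t)) has_real_derivative
    2 * (\<Sum>i<m. (u i t - (\<Sum>j<m. u j t) / m) * D i)) (at t)"
proof -
  let ?d = "\<lambda>i. u i t - (\<Sum>j<m. u j t) / m"
  have "((\<lambda>t. variance_sum m (\<lambda>i. u i t)) has_real_derivative
      (\<Sum>i<m. 2 * (?d i * (D i - (\<Sum>j<m. D j) / m)))) (at t)"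
    unfolding variance_sum_def
  proof (rule DERIV_sum)
    fix i assume "i \<in> {..<m}"
    moreover have "((\<lambda>t. (\<Sum>j<m. u j t) / m) has_real_derivative (\<Sum>j<m. D j) / m) (at t)"
      using assms by (intro DERIV_cdivide DERIV_sum) auto
    ultimately have "((\<lambda>t. u i t - (\<Sum>j<m. u j t) / m) has_real_derivative D i - (\<Sum>j<m. D j) / m) (at t)"
      using assms(2) by (intro DERIV_diff) auto
    from DERIV_power[OF this, of 2]
    show "((\<lambda>t. (u i t - (\<Sum>j<m. u j t) / m)\<^sup>2) has_real_derivative
        2 * (?d i * (D i - (\<Sum>j<m. D j) / m))) (at t)"
      by (simp add: mult_ac)
  qed
  also have "(\<Sum>i<m. 2 * (?d i * (D i - (\<Sum>j<m. D j) / m)))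
      = 2 * (\<Sum>i<m. ?d i * D i) - 2 * ((\<Sum>i<m. ?d i) * ((\<Sum>j<m. D j) / m))"
    unfolding sum_distrib_left sum_distrib_right sum_subtractf[symmetric]
    by (simp only: right_diff_distrib)
  also have "\<dots> = 2 * (\<Sum>i<m. ?d i * D i)"
    by (simp add: sum_deviation[OF assms(1)])
  finally show ?thesis .
qed

text \<open>In the derivative of \<open>V\<close> the rate contributes \<open>2 * Re l * V\<close>,
  and the coupling contributes \<open>- 2 * g\<close> times the Dirichlet forms of the real and
  imaginary deviations, which the second eigenvalue bounds from below. The weight
  \<open>exp (2 * \<mu> * t)\<close> turns the resulting inequality into monotonicity.\<close>

lemma variance_sum_decay:
  fixes z :: "nat \<Rightarrow> real \<Rightarrow> complex" and l :: complex and g :: real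
  assumes "weighted_graph m \<alpha>" "connected_graph m \<alpha>" "m \<ge> 2"
    and "0 \<le> g" "Re l - g * second_eigenvalue (laplacian m \<alpha>) \<le> - \<mu>" "a \<le> b"
    and cont: "\<And>i. i < m \<Longrightarrow> continuous_on {a..b} (z i)"
    and der: "\<And>i t. i < m \<Longrightarrow> a < t \<Longrightarrow> t < b \<Longrightarrow>
      (z i has_vector_derivative l * z i t + g * (\<Sum>j<m. \<alpha> i j * (z j t - z i t))) (at t)"
  defines "V \<equiv> \<lambda>t. variance_sum m (\<lambda>i. Re (z i t)) + variance_sum m (\<lambda>i. Im (z i t))"
  shows "exp (2 * \<mu> * b) * V b \<le> exp (2 * \<mu> * a) * V a"
proof (rule DERIV_nonpos_imp_decreasing_open[OF \<open>a \<le> b\<close>])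
  \<comment> \<open>At the end points, where the signal may switch, continuity is enough.\<close>
  show "continuous_on {a..b} (\<lambda>t. exp (2 * \<mu> * t) * V t)"
    unfolding V_def variance_sum_def divide_inverse by (intro continuous_intros cont) auto
next
  fix t assume t: "a < t" "t < b"
  define u where "u i = Re (z i t)" for i
  define w where "w i = Im (z i t)" for i
  define du where "du i = u i - (\<Sum>j<m. u j) / m" for i
  define dw where "dw i = w i - (\<Sum>j<m. w j) / m" for i
  have m: "m > 0" using assms(3) by simp
  have s0: "(\<Sum>i<m. du i) = 0" "(\<Sum>i<m. dw i) = 0"
    using sum_deviation[OF m] by (simp_all add: du_def dw_def)
  have lap_dev: "lap m \<alpha> u = lap m \<alpha> du" "lap m \<alpha> w = lap m \<alpha> dw"
    by (simp_all add: du_def[abs_def] dw_def[abs_def] lap_diff_const)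
  have V: "V t = (\<Sum>i<m. (du i)\<^sup>2) + (\<Sum>i<m. (dw i)\<^sup>2)"
    by (simp add: V_def variance_sum_def du_def dw_def u_def w_def)
  define D where "D i = l * z i t + g * (\<Sum>j<m. \<alpha> i j * (z j t - z i t))" for i
  have Re_D: "Re (D i) = Re l * u i - Im l * w i - g * lap m \<alpha> du i" for i
    by (simp add: D_def lap_dev(1)[symmetric] lap_def u_def w_def Re_sum algebra_simps sum_subtractf)
  have Im_D: "Im (D i) = Re l * w i + Im l * u i - g * lap m \<alpha> dw i" for i
    by (simp add: D_def lap_dev(2)[symmetric] lap_def u_def w_def Im_sum algebra_simps sum_subtractf)
  have "((\<lambda>t. Re (z i t)) has_real_derivative Re (D i)) (at t)"
    "((\<lambda>t. Im (z i t)) has_real_derivative Im (D i)) (at t)" if "i < m" for i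
    using bounded_linear.has_vector_derivative[OF bounded_linear_Re der[OF that t]]
      bounded_linear.has_vector_derivative[OF bounded_linear_Im der[OF that t]]
    by (simp_all add: has_real_derivative_iff_has_vector_derivative D_def)
  from has_real_derivative_variance_sum[OF m this(1)] has_real_derivative_variance_sum[OF m this(2)]
  have dV: "(V has_real_derivative 2 * ((\<Sum>i<m. du i * Re (D i)) + (\<Sum>i<m. dw i * Im (D i)))) (at t)"
    unfolding V_def by (auto intro!: derivative_eq_intros simp: du_def dw_def u_def w_def)
  \<comment> \<open>Against a family of sum 0 a constant may be subtracted; this replaces
    \<open>u\<close> and \<open>w\<close> by their deviations.\<close>
  have dev: "(\<Sum>i<m. d i * x i) = (\<Sum>i<m. d i * (x i - c))"
    if "(\<Sum>i<m. d i) = 0" for d x :: "nat \<Rightarrow> real" and c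
    using that by (simp add: right_diff_distrib sum_subtractf sum_distrib_right[symmetric])
  have 1: "(\<Sum>i<m. du i * u i) = (\<Sum>i<m. (du i)\<^sup>2)" "(\<Sum>i<m. du i * w i) = (\<Sum>i<m. du i * dw i)"
    unfolding dev[OF s0(1), of u "(\<Sum>j<m. u j) / m"] dev[OF s0(1), of w "(\<Sum>j<m. w j) / m"]
    by (simp_all add: du_def dw_def power2_eq_square)
  have 2: "(\<Sum>i<m. dw i * w i) = (\<Sum>i<m. (dw i)\<^sup>2)" "(\<Sum>i<m. dw i * u i) = (\<Sum>i<m. du i * dw i)"
    unfolding dev[OF s0(2), of u "(\<Sum>j<m. u j) / m"] dev[OF s0(2), of w "(\<Sum>j<m. w j) / m"]
    by (simp_all add: du_def dw_def power2_eq_square mult.commute)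
  have "(\<Sum>i<m. du i * Re (D i)) = Re l * (\<Sum>i<m. du i * u i) - Im l * (\<Sum>i<m. du i * w i)
      - g * (\<Sum>i<m. du i * lap m \<alpha> du i)"
    by (simp add: Re_D right_diff_distrib sum_subtractf sum_distrib_left mult.left_commute)
  moreover have "(\<Sum>i<m. dw i * Im (D i)) = Re l * (\<Sum>i<m. dw i * w i) + Im l * (\<Sum>i<m. dw i * u i)
      - g * (\<Sum>i<m. dw i * lap m \<alpha> dw i)"
    by (simp add: Im_D right_diff_distrib distrib_left sum.distrib sum_subtractf sum_distrib_left mult.left_commute)
  \<comment> \<open>The two terms with \<open>Im l\<close> carry the same sum of
    \<open>du i * dw i\<close> with opposite signs and cancel: the imaginary part only
    rotates.\<close>
  ultimately have "(\<Sum>i<m. du i * Re (D i)) + (\<Sum>i<m. dw i * Im (D i))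
      = Re l * V t - g * ((\<Sum>i<m. du i * lap m \<alpha> du i) + (\<Sum>i<m. dw i * lap m \<alpha> dw i))"
    by (simp add: 1 2 V algebra_simps)
  also have "\<dots> \<le> Re l * V t - g * (second_eigenvalue (laplacian m \<alpha>) * V t)"
    using second_eigenvalue_spec(3)[OF assms(1-3) s0(1)] second_eigenvalue_spec(3)[OF assms(1-3) s0(2)]
      \<open>0 \<le> g\<close> by (intro diff_left_mono mult_left_mono) (simp_all add: V distrib_left)
  also have "\<dots> = (Re l - g * second_eigenvalue (laplacian m \<alpha>)) * V t"
    by (simp add: algebra_simps)
  also have "\<dots> \<le> - \<mu> * V t"
    using assms(5) by (intro mult_right_mono) (simp_all add: V_def variance_sum_nonneg)
  finally have le: "(\<Sum>i<m. du i * Re (D i)) + (\<Sum>i<m. dw i * Im (D i)) \<le> - \<mu> * V t" .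
  let ?S = "(\<Sum>i<m. du i * Re (D i)) + (\<Sum>i<m. dw i * Im (D i))"
  have "((\<lambda>t. exp (2 * \<mu> * t) * V t) has_real_derivative
      exp (2 * \<mu> * t) * (2 * (\<mu> * V t + ?S))) (at t)"
    using dV by (auto intro!: derivative_eq_intros simp: algebra_simps)
  moreover have "exp (2 * \<mu> * t) * (2 * (\<mu> * V t + ?S)) \<le> 0"
    using le by (intro mult_nonneg_nonpos) auto
  ultimately show "\<exists>y. ((\<lambda>t. exp (2 * \<mu> * t) * V t) has_real_derivative y) (at t) \<and> y \<le> 0"
    by blast
qed

section \<open>Passing through the switching instants\<close>

text \<open>Monotonicity on intervals of constant signal is chained through the switching instants
  up to the last one not after \<open>t\<close>. The dwell time gives
  \<open>\<tau> k \<ge> k * h\<close>, so finitely many intervals reach \<open>t\<close>.\<close>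

lemma admissible_signal_nonincreasing:
  fixes F :: "real \<Rightarrow> real"
  assumes "admissible_signal h v \<sigma>" "h > 0" "t \<ge> 0"
    and step: "\<And>a b. 0 \<le> a \<Longrightarrow> a < b \<Longrightarrow> \<forall>s\<in>{a..<b}. \<sigma> s = \<sigma> a \<Longrightarrow> F b \<le> F a"
  shows "F t \<le> F 0"
proof -
  obtain \<tau> :: "nat \<Rightarrow> real" where \<tau>: "\<tau> 0 = 0" "strict_mono \<tau>"
    "\<And>k. \<tau> (Suc k) - \<tau> k \<ge> h" "\<And>k s. s \<in> {\<tau> k..<\<tau> (Suc k)} \<Longrightarrow> \<sigma> s = \<sigma> (\<tau> k)"
    using assms(1) unfolding admissible_signal_def by metis
  have nonneg: "0 \<le> \<tau> k" for k
    using strict_mono_mono[OF \<tau>(2)] \<tau>(1) by (metis le0 monoD)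
  have within: "F s \<le> F (\<tau> k)" if "\<tau> k \<le> s" "s \<le> \<tau> (Suc k)" for s k
  proof (cases "s = \<tau> k")
    case False
    have const: "\<forall>s'\<in>{\<tau> k..<s}. \<sigma> s' = \<sigma> (\<tau> k)"
    proof
      fix s' assume "s' \<in> {\<tau> k..<s}"
      then show "\<sigma> s' = \<sigma> (\<tau> k)" using that by (intro \<tau>(4)) auto
    qed
    have "\<tau> k < s" using that False by simp
    then show ?thesis using step[OF nonneg _ const] by blast
  qed simp
  have base: "F (\<tau> k) \<le> F 0" for k
  proof (induction k)
    case (Suc k)
    have "\<tau> k \<le> \<tau> (Suc k)" using \<tau>(3)[of k] \<open>h > 0\<close> by linarith
    then have "F (\<tau> (Suc k)) \<le> F (\<tau> k)" by (rule within) simp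
    with Suc show ?case by simp
  qed (simp add: \<tau>(1))
  have "real k * h \<le> \<tau> k" for k
  proof (induction k)
    case (Suc k)
    then show ?case using \<tau>(3)[of k] by (simp add: algebra_simps)
  qed (simp add: \<tau>(1))
  moreover obtain k where "t < real k * h" using reals_Archimedean3[OF \<open>h > 0\<close>] by blast
  ultimately have "t < \<tau> k" by (meson less_le_trans)
  \<comment> \<open>The least index whose instant exceeds \<open>t\<close> is not 0, as
    \<open>\<tau> 0 = 0\<close>; its predecessor starts the interval containing
    \<open>t\<close>.\<close>
  then obtain k' where "t < \<tau> k'" "\<And>j. j < k' \<Longrightarrow> \<not> t < \<tau> j"
    using exists_least_iff[of "\<lambda>k. t < \<tau> k"] by auto
  moreover from this \<tau>(1) \<open>t \<ge> 0\<close> obtain j where "k' = Suc j" by (cases k') auto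
  ultimately have "\<tau> j \<le> t" "t \<le> \<tau> (Suc j)" by (auto simp: not_less)
  from within[OF this] base[of j] show ?thesis by linarith
qed

section \<open>Decoupling into components, and sufficiency of the condition\<close>

lemma mat_diag_mult_vec_index:
  assumes "y \<in> carrier_vec n" "k < n"
  shows "(mat_diag n f *\<^sub>v y) $ k = f k * (y $ k :: complex)"
proof -
  have "(mat_diag n f *\<^sub>v y) $ k = (\<Sum>l\<in>{0..<n}. if l = k then f k * y $ l else 0)"
    using assms by (auto simp: mat_diag_def scalar_prod_def simp del: sum.delta sum.delta' intro!: sum.cong)
  then show ?thesis using assms by simp
qed

lemma agent_rhs_diag_index:
  assumes "x i \<in> carrier_vec n" "k < n"
  shows "agent_rhs m n (mat_diag n lam) (mat_diag n (\<lambda>k. complex_of_real (\<gamma> k))) \<alpha> x i $ k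
    = lam k * x i $ k + \<gamma> k * (\<Sum>j<m. \<alpha> i j * (x j $ k - x i $ k))"
proof -
  let ?y = "vec n (\<lambda>k. \<Sum>j<m. complex_of_real (\<alpha> i j) * (x j $ k - x i $ k))"
  have "dim_vec (mat_diag n (\<lambda>k. complex_of_real (\<gamma> k)) *\<^sub>v ?y) = n" by (simp add: mat_diag_def)
  then show ?thesis
    unfolding agent_rhs_def using assms mat_diag_mult_vec_index[OF assms, of lam]
      mat_diag_mult_vec_index[of ?y n k "\<lambda>k. complex_of_real (\<gamma> k)"]
    by (simp del: index_mult_mat_vec)
qed

lemma vec_norm2_squared:
  assumes "y \<in> carrier_vec n"
  shows "(vec_norm2 y)\<^sup>2 = (\<Sum>k<n. (Re (y $ k))\<^sup>2 + (Im (y $ k))\<^sup>2)"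
  using assms by (simp add: vec_norm2_def L2_set_def sum_nonneg cmod_power2)

lemma vec_norm2_nonneg: "0 \<le> vec_norm2 y"
  by (simp add: vec_norm2_def L2_set_nonneg)

text \<open>For each component the same weighted Lyapunov function decreases under every graph, so
  its decay survives arbitrary switching; adding up the components gives the Euclidean
  bound.\<close>

lemma consensus_if_modes_decay:
  fixes \<gamma> :: "nat \<Rightarrow> real" and lam :: "nat \<Rightarrow> complex"
  assumes "admissible_signal h v \<sigma>" "h > 0" "m \<ge> 2" "\<mu> > 0"
    and graphs: "\<And>p. p \<in> {1..v} \<Longrightarrow> weighted_graph m (W p) \<and> connected_graph m (W p)"
    and modes: "\<And>p k. p \<in> {1..v} \<Longrightarrow> k < n \<Longrightarrow>
      0 \<le> \<gamma> k \<and> Re (lam k) - \<gamma> k * second_eigenvalue (laplacian m (W p)) \<le> - \<mu>"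
  shows "reaches_consensus_exponentially m n (mat_diag n lam) (mat_diag n (\<lambda>k. complex_of_real (\<gamma> k))) W \<sigma>"
  unfolding reaches_consensus_exponentially_def
\<comment> \<open>The squared distance is at most 2 times the total Lyapunov function, whose initial
  value is at most \<open>m\<close> times the largest squared initial norm.\<close>
proof (rule exI[of _ "sqrt (2 * m)"], intro conjI exI[of _ \<mu>] allI impI)
  fix x i j and t :: real
  let ?S = "mat_diag n lam" and ?\<Gamma> = "mat_diag n (\<lambda>k. complex_of_real (\<gamma> k))"
  assume sol: "is_solution m n ?S ?\<Gamma> W \<sigma> x" and t: "t \<ge> 0" and i: "i < m" and j: "j < m"
  have carr: "x i t \<in> carrier_vec n" if "i < m" "t \<ge> 0" for i t
    using sol that unfolding is_solution_def by blast
  define V where "V k t = variance_sum m (\<lambda>i. Re (x i t $ k)) + variance_sum m (\<lambda>i. Im (x i t $ k))" for k t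
  have decay: "exp (2 * \<mu> * t) * V k t \<le> V k 0" if k: "k < n" for k
  proof -
    have step: "exp (2 * \<mu> * b) * V k b \<le> exp (2 * \<mu> * a) * V k a"
      if ab: "0 \<le> a" "a < b" "\<forall>s\<in>{a..<b}. \<sigma> s = \<sigma> a" for a b
    proof -
      have p: "\<sigma> a \<in> {1..v}" using assms(1) ab(1) by (simp add: admissible_signal_def)
      have "((\<lambda>s. x i s $ k) has_vector_derivative
          lam k * x i s $ k + \<gamma> k * (\<Sum>j<m. W (\<sigma> a) i j * (x j s $ k - x i s $ k))) (at s)"
        if "i < m" "a < s" "s < b" for i s
      proof -
        have s: "s \<in> {a..<b}" "s \<in> {a<..<b}" using that by auto
        have "((\<lambda>s. x i s $ k) has_vector_derivative
            agent_rhs m n ?S ?\<Gamma> (W (\<sigma> s)) (\<lambda>j. x j s) i $ k) (at s within {a..<b})"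
          using sol ab s(1) \<open>i < m\<close> k unfolding is_solution_def by blast
        \<comment> \<open>Passing to the open interval makes the derivative within
          \<open>{a..<b}\<close> an ordinary one at interior points.\<close>
        then have "((\<lambda>s. x i s $ k) has_vector_derivative
            agent_rhs m n ?S ?\<Gamma> (W (\<sigma> s)) (\<lambda>j. x j s) i $ k) (at s within {a<..<b})"
          unfolding has_vector_derivative_def by (rule has_derivative_subset) auto
        moreover have "x i s \<in> carrier_vec n" using that ab(1) by (intro carr) auto
        ultimately show ?thesis
          unfolding bspec[OF ab(3) s(1)] at_within_open[OF s(2) open_greaterThanLessThan]
          by (subst (asm) agent_rhs_diag_index[OF _ k])
      qed
      moreover have "continuous_on {a..b} (\<lambda>s. x i s $ k)" if "i < m" for i
      proof (rule continuous_on_subset)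
        show "continuous_on {0..} (\<lambda>s. x i s $ k)"
          using sol that k unfolding is_solution_def by blast
      qed (use ab(1) in auto)
      ultimately show ?thesis
        unfolding V_def using graphs[OF p] modes[OF p k] assms(3) less_imp_le[OF ab(2)]
        by (intro variance_sum_decay[where \<alpha> = "W (\<sigma> a)" and z = "\<lambda>i s. x i s $ k"
            and l = "lam k" and g = "\<gamma> k"]) blast+
    qed
    have "exp (2 * \<mu> * t) * V k t \<le> exp (2 * \<mu> * 0) * V k 0"
      by (rule admissible_signal_nonincreasing[OF assms(1,2) t, where F = "\<lambda>t. exp (2 * \<mu> * t) * V k t"])
         (rule step)
    then show ?thesis by simp
  qed
  define N where "N = Max ((\<lambda>k. vec_norm2 (x k 0)) ` {..<m})"
  have N: "vec_norm2 (x i 0) \<le> N" if "i < m" for i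
    unfolding N_def using that by (intro Max_ge) auto
  have "0 \<le> N" using N[OF i] vec_norm2_nonneg[of "x i 0"] by linarith
  have "(\<Sum>k<n. V k 0) \<le> (\<Sum>k<n. \<Sum>i<m. (Re (x i 0 $ k))\<^sup>2 + (Im (x i 0 $ k))\<^sup>2)"
    unfolding V_def sum.distrib by (intro sum_mono add_mono variance_sum_le)
  also have "\<dots> = (\<Sum>i<m. \<Sum>k<n. (Re (x i 0 $ k))\<^sup>2 + (Im (x i 0 $ k))\<^sup>2)"
    by (rule sum.swap)
  also have "\<dots> = (\<Sum>i<m. (vec_norm2 (x i 0))\<^sup>2)"
    by (intro sum.cong refl vec_norm2_squared[symmetric] carr) auto
  also have "\<dots> \<le> (\<Sum>i<m. N\<^sup>2)"
    using N by (intro sum_mono power_mono) (auto simp: vec_norm2_nonneg)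
  finally have init: "(\<Sum>k<n. V k 0) \<le> m * N\<^sup>2" by simp
  have decay': "V k t \<le> exp (- 2 * \<mu> * t) * V k 0" if "k < n" for k
    using decay[OF that] by (simp add: exp_minus field_simps)
  have "x i t - x j t \<in> carrier_vec n" using carr[OF i t] carr[OF j t] by simp
  from vec_norm2_squared[OF this] have "(vec_norm2 (x i t - x j t))\<^sup>2
      = (\<Sum>k<n. (Re (x i t $ k) - Re (x j t $ k))\<^sup>2 + (Im (x i t $ k) - Im (x j t $ k))\<^sup>2)"
    using carr[OF i t] carr[OF j t] by simp
  also have "\<dots> \<le> (\<Sum>k<n. 2 * V k t)"
  proof (rule sum_mono)
    fix k
    show "(Re (x i t $ k) - Re (x j t $ k))\<^sup>2 + (Im (x i t $ k) - Im (x j t $ k))\<^sup>2 \<le> 2 * V k t"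
      unfolding V_def distrib_left
      by (intro add_mono diff_squared_le_variance_sum[OF i j, of "\<lambda>i. Re (x i t $ k)"]
          diff_squared_le_variance_sum[OF i j, of "\<lambda>i. Im (x i t $ k)"])
  qed
  also have "\<dots> \<le> (\<Sum>k<n. 2 * (exp (- 2 * \<mu> * t) * V k 0))"
    by (intro sum_mono mult_left_mono decay') auto
  also have "\<dots> = 2 * exp (- 2 * \<mu> * t) * (\<Sum>k<n. V k 0)"
    by (simp add: sum_distrib_left mult.assoc)
  also have "\<dots> \<le> 2 * exp (- 2 * \<mu> * t) * (m * N\<^sup>2)"
    by (rule mult_left_mono[OF init]) simp
  also have "\<dots> = (sqrt (2 * m) * exp (- \<mu> * t) * N)\<^sup>2"
    using exp_double[of "- \<mu> * t"] by (simp add: power_mult_distrib mult_ac)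
  finally show "vec_norm2 (x i t - x j t)
      \<le> sqrt (2 * m) * exp (- \<mu> * t) * Max ((\<lambda>k. vec_norm2 (x k 0)) ` {..<m})"
    unfolding N_def[symmetric]
    by (rule power2_le_imp_le) (use \<open>0 \<le> N\<close> in simp)
qed (use \<open>m \<ge> 2\<close> \<open>\<mu> > 0\<close> in auto)

section \<open>Necessity of the condition: an undamped eigenmode\<close>

lemma constant_signal_admissible:
  assumes "h > 0" "p \<in> {1..v}"
  shows "admissible_signal h v (\<lambda>_. p)"
  unfolding admissible_signal_def
  using assms by (auto intro!: exI[of _ "\<lambda>k. real k * h"] strict_monoI simp: algebra_simps)

text \<open>On an eigenvector the coupling acts as multiplication by
  \<open>- \<gamma> 0 * \<rho>\<close>, so component 0 obeys a scalar linear equation; the other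
  components stay 0.\<close>

lemma eigenmode_is_solution:
  fixes \<gamma> :: "nat \<Rightarrow> real" and lam :: "nat \<Rightarrow> complex"
  assumes "\<And>i. i < m \<Longrightarrow> lap m (W p) w i = \<rho> * w i"
  shows "is_solution m n (mat_diag n lam) (mat_diag n (\<lambda>k. complex_of_real (\<gamma> k))) W (\<lambda>_. p)
    (\<lambda>i t. vec n (\<lambda>k. if k = 0 then w i * exp ((lam 0 - \<gamma> 0 * \<rho>) * t) else 0))"
proof -
  define E where "E t = exp ((lam 0 - \<gamma> 0 * \<rho>) * complex_of_real t)" for t
  \<comment> \<open>The arbitrary set \<open>X\<close> covers the one-sided derivatives at left end
    points.\<close>
  have E: "(E has_vector_derivative (lam 0 - \<gamma> 0 * \<rho>) * E t) (at t within X)" for t X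
    unfolding E_def
    by (rule has_vector_derivative_real_field) (auto intro!: derivative_eq_intros)
  have "continuous_on {0..} (\<lambda>t. if k = (0::nat) then w i * E t else 0)" for i k
    unfolding E_def by (cases "k = 0") (auto intro!: continuous_intros)
  moreover have "((\<lambda>s. w i * E s) has_vector_derivative
      lam 0 * (w i * E t) + \<gamma> 0 * (\<Sum>j<m. W p i j * (w j * E t - w i * E t))) (at t within X)"
    if "i < m" for i t X
  proof -
    have "complex_of_real (\<rho> * w i) = complex_of_real (lap m (W p) w i)"
      using assms[OF that] by simp
    moreover have "(\<Sum>j<m. W p i j * (w j * E t - w i * E t)) = - (complex_of_real (lap m (W p) w i) * E t)"
      unfolding lap_def of_real_sum sum_distrib_right sum_negf[symmetric]
      by (intro sum.cong) (simp_all add: algebra_simps)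
    ultimately have "(\<Sum>j<m. W p i j * (w j * E t - w i * E t)) = - (\<rho> * w i * E t)"
      by simp
    then have "lam 0 * (w i * E t) + \<gamma> 0 * (\<Sum>j<m. W p i j * (w j * E t - w i * E t))
        = w i * ((lam 0 - \<gamma> 0 * \<rho>) * E t)"
      by (simp add: algebra_simps)
    then show ?thesis
      using has_vector_derivative_mult_right[OF E, of "complex_of_real (w i)"] by simp
  qed
  ultimately show ?thesis
    unfolding is_solution_def E_def[symmetric]
    by (auto simp: agent_rhs_diag_index)
qed

lemma vec_norm2_ge_component:
  assumes "y \<in> carrier_vec n" "k < n"
  shows "cmod (y $ k) \<le> vec_norm2 y"
  using assms member_le_L2_set[of "{..<n}" k "\<lambda>k. cmod (y $ k)"] by (simp add: vec_norm2_def)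

text \<open>If the real part were nonnegative, the eigenmode would keep agents \<open>i\<close> and
  \<open>j\<close> at distance at least \<open>\<bar>w i - w j\<bar>\<close> forever, while
  exponential consensus sends this distance to 0.\<close>

lemma consensus_imp_mode_decays:
  fixes \<gamma> :: "nat \<Rightarrow> real" and lam :: "nat \<Rightarrow> complex"
  assumes "reaches_consensus_exponentially m n (mat_diag n lam) (mat_diag n (\<lambda>k. complex_of_real (\<gamma> k)))
      W (\<lambda>_. p)"
    and "\<And>i. i < m \<Longrightarrow> lap m (W p) w i = \<rho> * w i" "n \<ge> 1"
    and "i < m" "j < m" "w i \<noteq> w j"
  shows "Re (lam 0) - \<gamma> 0 * \<rho> < 0"
proof (rule ccontr)
  define \<kappa> where "\<kappa> = lam 0 - \<gamma> 0 * \<rho>"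
  define x where "x i t = vec n (\<lambda>k. if k = 0 then w i * exp (\<kappa> * complex_of_real t) else 0)" for i t
  assume "\<not> ?thesis"
  then have "Re \<kappa> \<ge> 0" by (simp add: \<kappa>_def)
  have "is_solution m n (mat_diag n lam) (mat_diag n (\<lambda>k. complex_of_real (\<gamma> k))) W (\<lambda>_. p) x"
    using eigenmode_is_solution[where m = m and W = W and w = w and p = p and \<rho> = \<rho>, OF assms(2)]
    unfolding x_def \<kappa>_def .
  then obtain c \<mu> where c: "c > 0" "\<mu> > 0" "\<And>t. t \<ge> 0 \<Longrightarrow>
      vec_norm2 (x i t - x j t) \<le> c * exp (- \<mu> * t) * Max ((\<lambda>k. vec_norm2 (x k 0)) ` {..<m})"
    using assms(1,4,5) unfolding reaches_consensus_exponentially_def by blast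
  define N where "N = Max ((\<lambda>k. vec_norm2 (x k 0)) ` {..<m})"
  have le: "\<bar>w i - w j\<bar> \<le> c * exp (- \<mu> * t) * N" if "t \<ge> 0" for t
  proof -
    have "\<bar>w i - w j\<bar> \<le> \<bar>w i - w j\<bar> * exp (Re \<kappa> * t)"
      using \<open>Re \<kappa> \<ge> 0\<close> that by (simp add: mult_left_le mult_le_cancel_left1)
    also have "\<dots> = cmod ((w i - w j) * exp (\<kappa> * t))"
      by (simp only: norm_mult norm_of_real norm_exp_eq_Re) (simp add: norm_mult flip: of_real_diff)
    also have "(w i - w j) * exp (\<kappa> * t) = (x i t - x j t) $ 0"
      using \<open>n \<ge> 1\<close> by (simp add: x_def algebra_simps)
    also have "cmod \<dots> \<le> vec_norm2 (x i t - x j t)"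
      using \<open>n \<ge> 1\<close> by (intro vec_norm2_ge_component[of _ n]) (auto simp: x_def)
    also have "\<dots> \<le> c * exp (- \<mu> * t) * N" using c(3)[OF that] by (simp add: N_def)
    finally show ?thesis .
  qed
  have "((\<lambda>t. c * exp (- \<mu> * t) * N) \<longlongrightarrow> c * 0 * N) at_top"
    by (intro tendsto_intros filterlim_compose[OF exp_at_bot] filterlim_tendsto_neg_mult_at_bot
        filterlim_ident) (use c(2) in auto)
  then have "\<bar>w i - w j\<bar> \<le> c * 0 * N"
  proof (rule tendsto_lowerbound)
    show "\<forall>\<^sub>F t in at_top. \<bar>w i - w j\<bar> \<le> c * exp (- \<mu> * t) * N"
      using eventually_ge_at_top[of 0] by eventually_elim (rule le)
  qed simp
  then show False using \<open>w i \<noteq> w j\<close> by simp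
qed

section \<open>The equivalence for the switched system\<close>

theorem theorem2:
  fixes m n nB r v :: nat
    and A B :: "real mat"
    and S Q Qinv \<Gamma> :: "complex mat"
    and lam :: "nat \<Rightarrow> complex"
    and \<gamma> :: "nat \<Rightarrow> real"
    and W :: "nat \<Rightarrow> nat \<Rightarrow> nat \<Rightarrow> real"
    and lam_Omega h :: real
  assumes "m \<ge> 2" and "n \<ge> 1" and "r \<ge> 1" and "nB < n" and "v \<ge> 1" and "h > 0"
    and "A \<in> carrier_mat n n" and "B \<in> carrier_mat n nB"
    and "diagonalizable_over_complex A"
    and "size {# z \<in># complex_spectrum A. Re z > 0 #} = r"
    and "stabilizable A B"
    and "Q \<in> carrier_mat n n" and "Qinv \<in> carrier_mat n n"
    and "inverts_mat Q Qinv" and "inverts_mat Qinv Q"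
    and "\<forall>k<n. eigenvector (map_mat complex_of_real A) (col Q k) (lam k)"
    and "S = Qinv * map_mat complex_of_real A * Q"
    and "S = mat_diag n lam"
    and "\<forall>k l. k \<le> l \<longrightarrow> l < n \<longrightarrow> Re (lam k) \<ge> Re (lam l)"
    and "\<forall>k<r. Re (lam k) > 0"
    and "\<forall>k. r \<le> k \<longrightarrow> k < n \<longrightarrow> Re (lam k) \<le> 0"
    and "\<forall>p\<in>{1..v}. weighted_graph m (W p) \<and> connected_graph m (W p)"
    and "lam_Omega = Min ((\<lambda>p. second_eigenvalue (laplacian m (W p))) ` {1..v})"
    and "\<Gamma> = mat_diag n (\<lambda>k. complex_of_real (\<gamma> k))"
    and "\<forall>k<r. \<gamma> k = \<gamma> 0"
    and "\<forall>k. r \<le> k \<longrightarrow> k < n \<longrightarrow> \<gamma> k = 1"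
  shows "(\<forall>\<sigma>. admissible_signal h v \<sigma> \<longrightarrow> reaches_consensus_exponentially m n S \<Gamma> W \<sigma>)
           \<longleftrightarrow> Re (lam 0) - \<gamma> 0 * lam_Omega < 0"
proof -
  let ?\<rho> = "\<lambda>p. second_eigenvalue (laplacian m (W p))"
  have graphs: "weighted_graph m (W p)" "connected_graph m (W p)" if "p \<in> {1..v}" for p
    using assms(22) that by auto
  have "lam_Omega \<in> ?\<rho> ` {1..v}"
    unfolding assms(23) using \<open>v \<ge> 1\<close> by (intro Min_in) auto
  \<comment> \<open>The graph attaining the minimum; the constant signal \<open>q\<close> is the
    worst case used for necessity.\<close>
  then obtain q where q: "q \<in> {1..v}" "lam_Omega = ?\<rho> q" by blast
  have pos: "lam_Omega > 0"
    using second_eigenvalue_spec(1)[OF graphs[OF q(1)] assms(1)] q(2) by simp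
  have min: "lam_Omega \<le> ?\<rho> p" if "p \<in> {1..v}" for p
    unfolding assms(23) using that by (intro Min_le) auto
  show ?thesis
  proof
    assume *: "\<forall>\<sigma>. admissible_signal h v \<sigma> \<longrightarrow> reaches_consensus_exponentially m n S \<Gamma> W \<sigma>"
    obtain w i where w: "(\<Sum>i<m. w i) = 0" "i < m" "w i \<noteq> 0"
      "\<And>i. i < m \<Longrightarrow> lap m (W q) w i = lam_Omega * w i"
      using second_eigenvalue_spec(2)[OF graphs[OF q(1)] assms(1)] q(2) by auto
    \<comment> \<open>A constant vector of sum 0 is 0, whereas \<open>w i \<noteq> 0\<close>; so the
      eigenmode involves real disagreement.\<close>
    have "\<exists>j<m. w i \<noteq> w j"
    proof (rule ccontr)
      assume "\<not> ?thesis"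
      then have "(\<Sum>j<m. w j) = (\<Sum>j<m. w i)" by (intro sum.cong) auto
      then show False using w \<open>m \<ge> 2\<close> by simp
    qed
    then obtain j where "j < m" "w i \<noteq> w j" by blast
    with * constant_signal_admissible[OF assms(6) q(1)] w assms(2)
    show "Re (lam 0) - \<gamma> 0 * lam_Omega < 0"
      unfolding assms(18) assms(24) by (intro consensus_imp_mode_decays[where w = w and i = i and j = j]) auto
  next
    assume neg: "Re (lam 0) - \<gamma> 0 * lam_Omega < 0"
    have "Re (lam 0) > 0" using assms(3,20) by simp
    \<comment> \<open>Mode 0 is unstable because \<open>r \<ge> 1\<close>, so the condition forces a
      positive gain, as the decay estimate requires.\<close>
    with neg pos have g: "\<gamma> 0 > 0" by (metis diff_less_0_iff_less less_trans zero_less_mult_pos2)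
    \<comment> \<open>The smaller of two margins: the first serves the modes below \<open>r\<close>,
      the second the modes with gain 1 and nonpositive real part.\<close>
    define \<mu> where "\<mu> = min (\<gamma> 0 * lam_Omega - Re (lam 0)) lam_Omega"
    have modes: "0 \<le> \<gamma> k \<and> Re (lam k) - \<gamma> k * ?\<rho> p \<le> - \<mu>" if "p \<in> {1..v}" "k < n" for p k
    proof (cases "k < r")
      case True
      have "Re (lam k) \<le> Re (lam 0)" using assms(19) that(2) by simp
      moreover have "\<gamma> 0 * lam_Omega \<le> \<gamma> 0 * ?\<rho> p" using g min[OF that(1)] by simp
      moreover have "\<mu> \<le> \<gamma> 0 * lam_Omega - Re (lam 0)" by (simp add: \<mu>_def)
      ultimately have "Re (lam k) - \<gamma> 0 * ?\<rho> p \<le> - \<mu>" by linarith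
      moreover have "\<gamma> k = \<gamma> 0" using assms(25) True by blast
      ultimately show ?thesis using g by simp
    next
      case False
      then have "Re (lam k) \<le> 0" "\<gamma> k = 1" using assms(21,26) that(2) by auto
      then show ?thesis using min[OF that(1)] by (simp add: \<mu>_def)
    qed
    have "\<mu> > 0" using neg pos by (simp add: \<mu>_def)
    show "\<forall>\<sigma>. admissible_signal h v \<sigma> \<longrightarrow> reaches_consensus_exponentially m n S \<Gamma> W \<sigma>"
      unfolding assms(18) assms(24)
      using consensus_if_modes_decay[OF _ assms(6,1) \<open>\<mu> > 0\<close>, where v = v and W = W and n = n and lam = lam and \<gamma> = \<gamma>]
        graphs modes by blast
  qed
qed

end
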